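(* Let $k\in\mathbb{N}$ and let $t_1,\ldots,t_n$ be group terms in $k$ variables. The following are equivalent: (1) $\mathcal{RG}\models e\le t_1\lor\ldots\lor t_n$; (2) $\{t_1,\ldots,t_n\}$ does not extend to an order of the free group $\mathbf{F}(k)$; (3) there exist $s_1,\ldots,s_m\in F(k)\setminus\{e\}$ such that $e\in\langle\!\langle \{t_1,\ldots,t_n,s_1^{\delta_1},\ldots,s_m^{\delta_m}\}\rangle\!\rangle$ for all $\delta_1,\ldots,\delta_m\in\{-1,1\}$.
   Context: An $\ell$-group is an algebra $\langle L,\land,\lor,\cdot,{}^{-1},e\rangle$ such that $\langle L,\cdot,{}^{-1},e\rangle$ is a group, $\langle L,\land,\lor\rangle$ is a lattice, and $a\le b$ implies $cad\le cbd$. An o-group is an $\ell$-group whose lattice order is total. $\mathcal{RG}$ is the variety of representable $\ell$-groups, i.e. the variety generated by the o-groups; $\mathcal{RG}\models e\le t_1\lor\dots\lor t_n$ means the inequation holds in all members of $\mathcal{RG}$ (equivalently all o-groups) under all assignments. $\mathbf{F}(k)$ is the free group on $k$ generators; group terms are identified with their images in it. For $S\subseteq F(k)$, $\langle\!\langle S\rangle\!\rangle$ is the normal subsemigroup generated by $S$ (the smallest subsemigroup containing $S$ and closed under conjugation $a\mapsto bab^{-1}$). An order of a group $\mathbf{G}$ is a partial order $\le$ on $G$ with $a\le b\Rightarrow ca\le cb$ and $ac\le bc$, such that every $a$ satisfies $e<a$, $a<e$ or $a=e$. A subset $S$ extends to an order if there is an order $\le$ with $e<s$ for all $s\in S$.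 *)

theory Defs
  imports "HOL-Algebra.Group"
begin

section \<open>Lattice-ordered groups\<close>

record 'a lgroup = "'a monoid" +
  lmeet :: "'a \<Rightarrow> 'a \<Rightarrow> 'a"
  ljoin :: "'a \<Rightarrow> 'a \<Rightarrow> 'a"

definition lle :: "('a, 'b) lgroup_scheme \<Rightarrow> 'a \<Rightarrow> 'a \<Rightarrow> bool" where
  "lle L a b \<longleftrightarrow> lmeet L a b = a"

locale l_group = group L for L :: "('a, 'b) lgroup_scheme" (structure) +
  assumes meet_closed: "\<lbrakk>a \<in> carrier L; b \<in> carrier L\<rbrakk> \<Longrightarrow> lmeet L a b \<in> carrier L"
    and join_closed: "\<lbrakk>a \<in> carrier L; b \<in> carrier L\<rbrakk> \<Longrightarrow> ljoin L a b \<in> carrier L"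
    and meet_comm: "\<lbrakk>a \<in> carrier L; b \<in> carrier L\<rbrakk> \<Longrightarrow> lmeet L a b = lmeet L b a"
    and join_comm: "\<lbrakk>a \<in> carrier L; b \<in> carrier L\<rbrakk> \<Longrightarrow> ljoin L a b = ljoin L b a"
    and meet_assoc: "\<lbrakk>a \<in> carrier L; b \<in> carrier L; c \<in> carrier L\<rbrakk>
      \<Longrightarrow> lmeet L (lmeet L a b) c = lmeet L a (lmeet L b c)"
    and join_assoc: "\<lbrakk>a \<in> carrier L; b \<in> carrier L; c \<in> carrier L\<rbrakk>
      \<Longrightarrow> ljoin L (ljoin L a b) c = ljoin L a (ljoin L b c)"
    and meet_join_absorb: "\<lbrakk>a \<in> carrier L; b \<in> carrier L\<rbrakk> \<Longrightarrow> lmeet L a (ljoin L a b) = a"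
    and join_meet_absorb: "\<lbrakk>a \<in> carrier L; b \<in> carrier L\<rbrakk> \<Longrightarrow> ljoin L a (lmeet L a b) = a"
    and mult_mono: "\<lbrakk>a \<in> carrier L; b \<in> carrier L; c \<in> carrier L; d \<in> carrier L; lle L a b\<rbrakk>
      \<Longrightarrow> lle L (c \<otimes> a \<otimes> d) (c \<otimes> b \<otimes> d)"

locale o_group = l_group +
  assumes total: "\<lbrakk>a \<in> carrier L; b \<in> carrier L\<rbrakk> \<Longrightarrow> lle L a b \<or> lle L b a"


section \<open>Terms and equations\<close>

datatype gterm = GVar nat | GOne | GMult gterm gterm | GInv gterm

primrec gvars :: "gterm \<Rightarrow> nat set" where
  "gvars (GVar i) = {i}"
| "gvars GOne = {}"
| "gvars (GMult s t) = gvars s \<union> gvars t"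
| "gvars (GInv t) = gvars t"

primrec geval :: "('a, 'b) monoid_scheme \<Rightarrow> (nat \<Rightarrow> 'a) \<Rightarrow> gterm \<Rightarrow> 'a" where
  "geval G \<rho> (GVar i) = \<rho> i"
| "geval G \<rho> GOne = \<one>\<^bsub>G\<^esub>"
| "geval G \<rho> (GMult s t) = geval G \<rho> s \<otimes>\<^bsub>G\<^esub> geval G \<rho> t"
| "geval G \<rho> (GInv t) = inv\<^bsub>G\<^esub> (geval G \<rho> t)"

datatype lterm = LVar nat | LOne | LMult lterm lterm | LInv lterm
  | LMeet lterm lterm | LJoin lterm lterm

primrec leval :: "('a, 'b) lgroup_scheme \<Rightarrow> (nat \<Rightarrow> 'a) \<Rightarrow> lterm \<Rightarrow> 'a" where
  "leval L \<rho> (LVar i) = \<rho> i"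
| "leval L \<rho> LOne = \<one>\<^bsub>L\<^esub>"
| "leval L \<rho> (LMult s t) = leval L \<rho> s \<otimes>\<^bsub>L\<^esub> leval L \<rho> t"
| "leval L \<rho> (LInv t) = inv\<^bsub>L\<^esub> (leval L \<rho> t)"
| "leval L \<rho> (LMeet s t) = lmeet L (leval L \<rho> s) (leval L \<rho> t)"
| "leval L \<rho> (LJoin s t) = ljoin L (leval L \<rho> s) (leval L \<rho> t)"

primrec lterm_of :: "gterm \<Rightarrow> lterm" where
  "lterm_of (GVar i) = LVar i"
| "lterm_of GOne = LOne"
| "lterm_of (GMult s t) = LMult (lterm_of s) (lterm_of t)"
| "lterm_of (GInv t) = LInv (lterm_of t)"

text \<open>The join of a nonempty list of terms; the value on the empty list is irrelevant.\<close>

definition ljoins :: "lterm list \<Rightarrow> lterm" where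
  "ljoins ts = foldl LJoin (hd ts) (tl ts)"

type_synonym lequation = "lterm \<times> lterm"

definition lineq :: "lterm \<Rightarrow> lterm \<Rightarrow> lequation" where
  "lineq s t = (LMeet s t, s)"

definition satisfies :: "('a, 'b) lgroup_scheme \<Rightarrow> lequation \<Rightarrow> bool" where
  "satisfies L \<epsilon> \<longleftrightarrow> (\<forall>\<rho>. range \<rho> \<subseteq> carrier L \<longrightarrow> leval L \<rho> (fst \<epsilon>) = leval L \<rho> (snd \<epsilon>))"

definition class_satisfies :: "'a lgroup set \<Rightarrow> lequation \<Rightarrow> bool" where
  "class_satisfies K \<epsilon> \<longleftrightarrow> (\<forall>L\<in>K. satisfies L \<epsilon>)"

text \<open>
  A class of \<open>\<ell>\<close>-groups is here a set of structures whose carriers are subsets of one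
  type \<^typ>\<open>'a\<close>. An equation involves only finitely many variables, and a finitely generated
  \<open>\<ell>\<close>-group is countable; so for infinite \<^typ>\<open>'a\<close> the equations valid in the o-groups on
  \<^typ>\<open>'a\<close> are those valid in all o-groups, and likewise for the members of the variety
  that the o-groups generate.
\<close>

definition lgroup_variety :: "'a lgroup set \<Rightarrow> bool" where
  "lgroup_variety V \<longleftrightarrow> (\<exists>E. V = {L. l_group L \<and> (\<forall>\<epsilon>\<in>E. satisfies L \<epsilon>)})"

definition variety_generated_by :: "'a lgroup set \<Rightarrow> 'a lgroup set" where
  "variety_generated_by K = \<Inter> {V. lgroup_variety V \<and> K \<subseteq> V}"

definition RG :: "'a lgroup set" where
  "RG = variety_generated_by {L. o_group L}"


section \<open>The free group on k generators\<close>

text \<open>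
  Elements are the reduced words; the letter \<open>(i, True)\<close> stands for the generator with
  index \<open>i\<close> and \<open>(i, False)\<close> for its inverse.
\<close>

type_synonym letter = "nat \<times> bool"

definition cancels :: "letter \<Rightarrow> letter \<Rightarrow> bool" where
  "cancels a b \<longleftrightarrow> fst a = fst b \<and> snd a \<noteq> snd b"

definition reduced :: "letter list \<Rightarrow> bool" where
  "reduced w \<longleftrightarrow> successively (\<lambda>a b. \<not> cancels a b) w"

fun push :: "letter \<Rightarrow> letter list \<Rightarrow> letter list" where
  "push a [] = [a]"
| "push a (b # w) = (if cancels a b then w else a # b # w)"

definition free_group :: "nat \<Rightarrow> letter list monoid" where
  "free_group k =
    \<lparr>carrier = {w. fst ` set w \<subseteq> {..<k} \<and> reduced w}, mult = foldr push, one = []\<rparr>"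

definition free_gen :: "nat \<Rightarrow> letter list" where
  "free_gen i = [(i, True)]"

definition free_image :: "nat \<Rightarrow> gterm \<Rightarrow> letter list" where
  "free_image k t = geval (free_group k) free_gen t"

lemma reduced_push: "reduced w \<Longrightarrow> reduced (push a w)"
  by (cases w) (auto simp: reduced_def successively_Cons)

lemma reduced_foldr_push: "reduced w \<Longrightarrow> reduced (foldr push u w)"
  by (induction u) (auto intro: reduced_push)

lemma letters_push: "fst ` set (push a w) \<subseteq> insert (fst a) (fst ` set w)"
  by (cases w) auto

lemma letters_foldr_push: "fst ` set (foldr push u w) \<subseteq> fst ` set u \<union> fst ` set w"
proof (induction u)
  case (Cons a u)
  have "fst ` set (foldr push (a # u) w) \<subseteq> insert (fst a) (fst ` set (foldr push u w))"
    using letters_push[of a "foldr push u w"] by simp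
  also have "\<dots> \<subseteq> insert (fst a) (fst ` set u \<union> fst ` set w)"
    using Cons.IH by (rule insert_mono)
  finally show ?case by simp
qed simp

lemma push_push_cancel:
  assumes "reduced w" and "cancels a b"
  shows "push a (push b w) = w"
proof (cases w)
  case Nil
  then show ?thesis using assms by simp
next
  case (Cons c v)
  show ?thesis
  proof (cases "cancels b c")
    case True
    then have "a = c" using assms(2) by (auto simp: cancels_def prod_eq_iff)
    then show ?thesis using True Cons assms(1)
      by (cases v) (auto simp: reduced_def)
  next
    case False
    then show ?thesis using Cons assms(2) by simp
  qed
qed

lemma foldr_push_push:
  assumes "reduced w"
  shows "foldr push (push a u) w = push a (foldr push u w)"
proof (cases u)
  case (Cons b v)
  then show ?thesis
    using push_push_cancel[OF reduced_foldr_push[OF assms], of a b v] by simp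
qed simp

lemma foldr_push_assoc:
  assumes "reduced w"
  shows "foldr push (foldr push u v) w = foldr push u (foldr push v w)"
  by (induction u) (simp_all add: foldr_push_push assms)

lemma foldr_push_Nil: "reduced u \<Longrightarrow> foldr push u [] = u"
proof (induction u)
  case (Cons a u)
  then show ?case by (cases u) (auto simp: reduced_def)
qed simp

definition word_inv :: "letter list \<Rightarrow> letter list" where
  "word_inv w = rev (map (\<lambda>(i, b). (i, \<not> b)) w)"

lemma foldr_push_word_inv: "reduced v \<Longrightarrow> foldr push (word_inv u) (foldr push u v) = v"
proof (induction u)
  case (Cons a u)
  then show ?case
    using push_push_cancel[OF reduced_foldr_push[OF Cons.prems], of "(fst a, \<not> snd a)" a u]
    by (auto simp: word_inv_def case_prod_beta cancels_def)
qed (simp add: word_inv_def)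

lemma free_group_is_group: "group (free_group k)"
proof (rule groupI)
  fix x y assume "x \<in> carrier (free_group k)" "y \<in> carrier (free_group k)"
  then show "x \<otimes>\<^bsub>free_group k\<^esub> y \<in> carrier (free_group k)"
    using order_trans[OF letters_foldr_push[of x y], of "{..<k}"] reduced_foldr_push[of y x]
    by (simp add: free_group_def)
next
  show "\<one>\<^bsub>free_group k\<^esub> \<in> carrier (free_group k)"
    by (simp add: free_group_def reduced_def)
next
  fix x y z
  assume "x \<in> carrier (free_group k)" "y \<in> carrier (free_group k)" "z \<in> carrier (free_group k)"
  then show "x \<otimes>\<^bsub>free_group k\<^esub> y \<otimes>\<^bsub>free_group k\<^esub> z
      = x \<otimes>\<^bsub>free_group k\<^esub> (y \<otimes>\<^bsub>free_group k\<^esub> z)"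
    by (simp add: free_group_def foldr_push_assoc)
next
  fix x assume "x \<in> carrier (free_group k)"
  then show "\<one>\<^bsub>free_group k\<^esub> \<otimes>\<^bsub>free_group k\<^esub> x = x"
    by (simp add: free_group_def)
next
  fix x assume x: "x \<in> carrier (free_group k)"
  let ?y = "foldr push (word_inv x) []"
  have red: "reduced []" by (simp add: reduced_def)
  have "fst ` set (word_inv x) = fst ` set x"
    by (force simp: word_inv_def)
  then have "?y \<in> carrier (free_group k)"
    using x order_trans[OF letters_foldr_push[of "word_inv x" "[]"], of "{..<k}"]
      reduced_foldr_push[OF red, of "word_inv x"]
    by (simp add: free_group_def)
  moreover have "foldr push ?y x = []"
    using x foldr_push_assoc[of x "word_inv x" "[]"] foldr_push_word_inv[OF red, of x]
    by (simp add: free_group_def foldr_push_Nil)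
  ultimately show "\<exists>y\<in>carrier (free_group k). y \<otimes>\<^bsub>free_group k\<^esub> x = \<one>\<^bsub>free_group k\<^esub>"
    by (auto simp: free_group_def)
qed


section \<open>Orders and normal subsemigroups\<close>

definition group_order :: "('a, 'b) monoid_scheme \<Rightarrow> 'a rel \<Rightarrow> bool" where
  "group_order G r \<longleftrightarrow>
    partial_order_on (carrier G) r \<and>
    (\<forall>a\<in>carrier G. \<forall>b\<in>carrier G. \<forall>c\<in>carrier G. (a, b) \<in> r \<longrightarrow>
      (c \<otimes>\<^bsub>G\<^esub> a, c \<otimes>\<^bsub>G\<^esub> b) \<in> r \<and> (a \<otimes>\<^bsub>G\<^esub> c, b \<otimes>\<^bsub>G\<^esub> c) \<in> r) \<and>
    (\<forall>a\<in>carrier G. (\<one>\<^bsub>G\<^esub>, a) \<in> r - Id \<or> (a, \<one>\<^bsub>G\<^esub>) \<in> r - Id \<or> a = \<one>\<^bsub>G\<^esub>)"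

definition extends_to_order :: "('a, 'b) monoid_scheme \<Rightarrow> 'a set \<Rightarrow> bool" where
  "extends_to_order G S \<longleftrightarrow> (\<exists>r. group_order G r \<and> (\<forall>s\<in>S. (\<one>\<^bsub>G\<^esub>, s) \<in> r - Id))"

inductive_set normal_subsemigroup :: "('a, 'b) monoid_scheme \<Rightarrow> 'a set \<Rightarrow> 'a set"
  for G S where
  incl: "a \<in> S \<Longrightarrow> a \<in> normal_subsemigroup G S"
| mult: "\<lbrakk>a \<in> normal_subsemigroup G S; b \<in> normal_subsemigroup G S\<rbrakk>
    \<Longrightarrow> a \<otimes>\<^bsub>G\<^esub> b \<in> normal_subsemigroup G S"
| conj: "\<lbrakk>a \<in> normal_subsemigroup G S; b \<in> carrier G\<rbrakk>
    \<Longrightarrow> b \<otimes>\<^bsub>G\<^esub> a \<otimes>\<^bsub>G\<^esub> inv\<^bsub>G\<^esub> b \<in> normal_subsemigroup G S"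

end

theory Submission
  imports Defs "HOL-Library.Countable"
begin

text \<open>
  (2) and (3): a set \<open>T\<close> that no finite list of elements refutes in the sense of (3) can be
  enlarged by \<open>s\<close> or by \<open>s\<inverse>\<close> for every \<open>s \<noteq> e\<close>, since refutations of both enlargements combine
  to one of \<open>T\<close>. Refutations use finitely many elements, so Zorn's lemma gives a maximal such set,
  and it generates the positive cone of an order.

  (1) and (2): if the \<open>t\<^sub>i\<close> are positive in some order of \<open>F(k)\<close>, the inequation fails in \<open>F(k)\<close>
  with the dual order. Conversely, if all \<open>t\<^sub>i\<close> are negative in an o-group under some assignment, then
  the dual order of the o-group is pulled back along the induced homomorphism and refined on the
  kernel by an order of \<open>F(k)\<close>. Such an order exists by Magnus: embed \<open>F(k)\<close> into the units of the
  integral power series in noncommuting variables by \<open>x\<^sub>i \<mapsto> 1 + X\<^sub>i\<close>, and call \<open>g\<close> positive if the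
  coefficient of \<open>g - 1\<close> at its least monomial (by length, then lexicographically) is positive.
\<close>

section \<open>Positive cones\<close>

text \<open>The strictly positive elements of an order. That \<open>P\<close> is disjoint from its
  set of inverses follows from \<open>\<one> \<notin> P\<close> and closure under products.\<close>

definition order_cone :: "('a, 'b) monoid_scheme \<Rightarrow> 'a set \<Rightarrow> bool" where
  "order_cone G P \<longleftrightarrow> P \<subseteq> carrier G \<and> \<one>\<^bsub>G\<^esub> \<notin> P \<and>
    (\<forall>a\<in>P. \<forall>b\<in>P. a \<otimes>\<^bsub>G\<^esub> b \<in> P) \<and>
    (\<forall>a\<in>P. \<forall>c\<in>carrier G. c \<otimes>\<^bsub>G\<^esub> a \<otimes>\<^bsub>G\<^esub> inv\<^bsub>G\<^esub> c \<in> P) \<and>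
    (\<forall>a\<in>carrier G. a \<noteq> \<one>\<^bsub>G\<^esub> \<longrightarrow> a \<in> P \<or> inv\<^bsub>G\<^esub> a \<in> P)"

lemma order_coneI:
  assumes "P \<subseteq> carrier G" "\<one>\<^bsub>G\<^esub> \<notin> P"
    and "\<And>a b. \<lbrakk>a \<in> P; b \<in> P\<rbrakk> \<Longrightarrow> a \<otimes>\<^bsub>G\<^esub> b \<in> P"
    and "\<And>a c. \<lbrakk>a \<in> P; c \<in> carrier G\<rbrakk> \<Longrightarrow> c \<otimes>\<^bsub>G\<^esub> a \<otimes>\<^bsub>G\<^esub> inv\<^bsub>G\<^esub> c \<in> P"
    and "\<And>a. \<lbrakk>a \<in> carrier G; a \<noteq> \<one>\<^bsub>G\<^esub>\<rbrakk> \<Longrightarrow> a \<in> P \<or> inv\<^bsub>G\<^esub> a \<in> P"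
  shows "order_cone G P"
  using assms by (simp add: order_cone_def)

lemma
  assumes "order_cone G P"
  shows order_cone_carrier: "a \<in> P \<Longrightarrow> a \<in> carrier G"
    and order_cone_one: "\<one>\<^bsub>G\<^esub> \<notin> P"
    and order_cone_mult: "\<lbrakk>a \<in> P; b \<in> P\<rbrakk> \<Longrightarrow> a \<otimes>\<^bsub>G\<^esub> b \<in> P"
    and order_cone_conj: "\<lbrakk>a \<in> P; c \<in> carrier G\<rbrakk> \<Longrightarrow> c \<otimes>\<^bsub>G\<^esub> a \<otimes>\<^bsub>G\<^esub> inv\<^bsub>G\<^esub> c \<in> P"
    and order_cone_total: "\<lbrakk>a \<in> carrier G; a \<noteq> \<one>\<^bsub>G\<^esub>\<rbrakk> \<Longrightarrow> a \<in> P \<or> inv\<^bsub>G\<^esub> a \<in> P"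
  using assms by (auto simp: order_cone_def)

context group
begin

lemma order_cone_inv_notin:
  assumes "order_cone G P" "a \<in> P"
  shows "inv a \<notin> P"
  using order_cone_mult[OF assms(1) assms(2), of "inv a"] order_cone_one[OF assms(1)]
    order_cone_carrier[OF assms] by auto

lemma order_cone_conj_inv:
  assumes "order_cone G P" "a \<in> P" "c \<in> carrier G"
  shows "inv c \<otimes> a \<otimes> c \<in> P"
  using order_cone_conj[OF assms(1,2), of "inv c"] assms(3) by simp

lemma inv_mult_cancel:
  assumes "a \<in> carrier G" "b \<in> carrier G"
  shows "inv a \<otimes> (a \<otimes> b) = b" "a \<otimes> (inv a \<otimes> b) = b"
  using assms by (simp_all add: m_assoc[symmetric])

lemma conj_eq_one:
  assumes "c \<otimes> a \<otimes> inv c = \<one>" "a \<in> carrier G" "c \<in> carrier G"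
  shows "a = \<one>"
proof -
  have "inv c \<otimes> (c \<otimes> a \<otimes> inv c) \<otimes> c = \<one>" using assms by simp
  then show ?thesis using assms(2,3) by (simp add: m_assoc inv_mult_cancel)
qed

lemma mult_inv_mult_cancel:
  assumes "a \<in> carrier G" "b \<in> carrier G" "c \<in> carrier G"
  shows "inv a \<otimes> b \<otimes> (inv b \<otimes> c) = inv a \<otimes> c"
  using assms by (simp add: m_assoc inv_mult_cancel)

text \<open>Left translation leaves \<open>inv a \<otimes> b\<close> fixed and right translation
  conjugates it, so normality of \<open>P\<close> gives invariance on the right.\<close>

lemma group_order_of_cone:
  assumes P: "order_cone G P"
  shows "group_order G {(a, b). a \<in> carrier G \<and> b \<in> carrier G \<and> (a = b \<or> inv a \<otimes> b \<in> P)}"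
    (is "group_order G ?r")
  unfolding group_order_def
proof (intro conjI ballI impI)
  have "trans ?r"
  proof (rule transI)
    fix a b c assume "(a, b) \<in> ?r" "(b, c) \<in> ?r"
    then show "(a, c) \<in> ?r"
      using order_cone_mult[OF P, of "inv a \<otimes> b" "inv b \<otimes> c"] mult_inv_mult_cancel[of a b c]
      by auto
  qed
  moreover have "antisym ?r"
  proof (rule antisymI)
    fix a b assume ab: "(a, b) \<in> ?r" "(b, a) \<in> ?r"
    have "inv (inv a \<otimes> b) = inv b \<otimes> a" if "a \<in> carrier G" "b \<in> carrier G"
      using that by (simp add: inv_mult_group)
    then show "a = b"
      using ab order_cone_inv_notin[OF P, of "inv a \<otimes> b"] by auto
  qed
  ultimately show "partial_order_on (carrier G) ?r"
    by (auto simp: partial_order_on_def preorder_on_def refl_on_def)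
next
  fix a b c
  assume G: "a \<in> carrier G" "b \<in> carrier G" "c \<in> carrier G" and ab: "(a, b) \<in> ?r"
  have "inv (c \<otimes> a) \<otimes> (c \<otimes> b) = inv a \<otimes> b"
    using G by (simp add: inv_mult_group m_assoc inv_mult_cancel)
  then show "(c \<otimes> a, c \<otimes> b) \<in> ?r" using G ab by auto
  have "inv (a \<otimes> c) \<otimes> (b \<otimes> c) = inv c \<otimes> (inv a \<otimes> b) \<otimes> c"
    using G by (simp add: inv_mult_group m_assoc)
  then show "(a \<otimes> c, b \<otimes> c) \<in> ?r"
    using G ab order_cone_conj_inv[OF P, of "inv a \<otimes> b" c] by auto
next
  fix a assume "a \<in> carrier G"
  then show "(\<one>, a) \<in> ?r - Id \<or> (a, \<one>) \<in> ?r - Id \<or> a = \<one>"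
    using order_cone_total[OF P, of a] by auto
qed

lemma order_cone_of_group_order:
  assumes r: "group_order G r"
  shows "order_cone G {a \<in> carrier G. (\<one>, a) \<in> r - Id}" (is "order_cone G ?P")
proof -
  have tr: "(a, c) \<in> r" if "(a, b) \<in> r" "(b, c) \<in> r" for a b c
    using r that unfolding group_order_def partial_order_on_def preorder_on_def
    by (meson transD)
  have as: "a = b" if "(a, b) \<in> r" "(b, a) \<in> r" for a b
    using r that unfolding group_order_def partial_order_on_def
    by (meson antisymD)
  have l: "(c \<otimes> a, c \<otimes> b) \<in> r"
    and rt: "(a \<otimes> c, b \<otimes> c) \<in> r"
    if "a \<in> carrier G" "b \<in> carrier G" "c \<in> carrier G" "(a, b) \<in> r" for a b c
    using r that unfolding group_order_def by blast+
  have tot: "(\<one>, a) \<in> r - Id \<or> (a, \<one>) \<in> r - Id \<or> a = \<one>" if "a \<in> carrier G" for a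
    using r that unfolding group_order_def by blast
  show ?thesis
  proof (rule order_coneI)
    fix a b assume ab: "a \<in> ?P" "b \<in> ?P"
    then have *: "a \<in> carrier G" "b \<in> carrier G" "(\<one>, a) \<in> r" "(\<one>, b) \<in> r" "\<one> \<noteq> a"
      by auto
    then have "(a, a \<otimes> b) \<in> r" using l[of \<one> b a] by simp
    moreover from this have "(\<one>, a \<otimes> b) \<in> r" using * tr by blast
    \<comment> \<open>Otherwise \<open>\<one> \<le> a \<le> a \<otimes> b = \<one>\<close> would
      force \<open>a = \<one>\<close>.\<close>
    moreover have "\<one> \<noteq> a \<otimes> b" using * calculation(1) as[of \<one> a] by metis
    ultimately show "a \<otimes> b \<in> ?P" using * by simp
  next
    fix a c assume a: "a \<in> ?P" and c: "c \<in> carrier G"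
    have "(c \<otimes> inv c, c \<otimes> a \<otimes> inv c) \<in> r"
      using a c l[of \<one> a c] rt[of c "c \<otimes> a" "inv c"] by auto
    moreover have "c \<otimes> a \<otimes> inv c \<noteq> \<one>" using a c conj_eq_one[of c a] by auto
    ultimately show "c \<otimes> a \<otimes> inv c \<in> ?P" using a c by auto
  next
    fix a assume a: "a \<in> carrier G" "a \<noteq> \<one>"
    have "(\<one>, inv a) \<in> r" if "(a, \<one>) \<in> r"
      using l[of a \<one> "inv a"] that a by auto
    then show "a \<in> ?P \<or> inv a \<in> ?P" 
      using a tot[of a] inv_eq_1_iff[of a] by (auto simp del: inv_eq_1_iff)
  qed auto
qed

lemma extends_to_order_iff_cone:
  assumes "S \<subseteq> carrier G"
  shows "extends_to_order G S \<longleftrightarrow> (\<exists>P. order_cone G P \<and> S \<subseteq> P)"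
proof
  assume "extends_to_order G S"
  then obtain r where "group_order G r" "\<forall>s\<in>S. (\<one>, s) \<in> r - Id"
    by (auto simp: extends_to_order_def)
  then show "\<exists>P. order_cone G P \<and> S \<subseteq> P"
    using order_cone_of_group_order[of r] assms by blast
next
  assume "\<exists>P. order_cone G P \<and> S \<subseteq> P"
  then obtain P where P: "order_cone G P" "S \<subseteq> P" by blast
  let ?r = "{(a, b). a \<in> carrier G \<and> b \<in> carrier G \<and> (a = b \<or> inv a \<otimes> b \<in> P)}"
  have "\<forall>s\<in>S. (\<one>, s) \<in> ?r - Id"
  proof
    fix s assume "s \<in> S"
    then have "s \<in> P" "s \<in> carrier G" "s \<noteq> \<one>" using P assms order_cone_one[OF P(1)] by auto
    then show "(\<one>, s) \<in> ?r - Id" by simp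
  qed
  then show "extends_to_order G S"
    unfolding extends_to_order_def using group_order_of_cone[OF P(1)] by blast
qed

text \<open>The lexicographic order: images in \<open>H\<close> are compared first and
  \<open>P\<close> settles the kernel. The kernel is normal and \<open>P\<close> is invariant under
  conjugation by all of \<open>G\<close>, so the combination is invariant too.\<close>

lemma order_cone_lex:
  assumes "group H" and h: "h \<in> hom G H" and Q: "order_cone H Q" and P: "order_cone G P"
  shows "order_cone G {a \<in> carrier G. h a \<in> Q \<or> h a = \<one>\<^bsub>H\<^esub> \<and> a \<in> P}" (is "order_cone G ?R")
proof -
  interpret H: group H by fact
  interpret h: group_hom G H h
    using h by (unfold_locales) auto
  show ?thesis
  proof (rule order_coneI)
    show "\<one> \<notin> ?R" using order_cone_one[OF P] order_cone_one[OF Q] by auto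
  next
    fix a b assume "a \<in> ?R" "b \<in> ?R"
    then show "a \<otimes> b \<in> ?R"
      using order_cone_mult[OF P, of a b] order_cone_mult[OF Q, of "h a" "h b"]
        order_cone_carrier[OF Q] by auto
  next
    fix a c assume "a \<in> ?R" "c \<in> carrier G"
    then show "c \<otimes> a \<otimes> inv c \<in> ?R"
      using order_cone_conj[OF P, of a c] order_cone_conj[OF Q, of "h a" "h c"] by auto
  next
    fix a assume "a \<in> carrier G" "a \<noteq> \<one>"
    then show "a \<in> ?R \<or> inv a \<in> ?R"
      using order_cone_total[OF P, of a] order_cone_total[OF Q, of "h a"] by auto
  qed auto
qed

end


section \<open>The combinatorial criterion for extending to an order\<close>

lemma normal_subsemigroup_mono:
  "S \<subseteq> T \<Longrightarrow> normal_subsemigroup G S \<subseteq> normal_subsemigroup G T"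
proof
  fix x assume "S \<subseteq> T" "x \<in> normal_subsemigroup G S"
  from this(2,1) show "x \<in> normal_subsemigroup G T"
    by induction (auto intro: normal_subsemigroup.intros)
qed

lemma normal_subsemigroup_finite_support:
  "x \<in> normal_subsemigroup G S \<Longrightarrow> \<exists>T. finite T \<and> T \<subseteq> S \<and> x \<in> normal_subsemigroup G T"
proof (induction rule: normal_subsemigroup.induct)
  case (incl a)
  then show ?case
    by (intro exI[of _ "{a}"]) (auto intro: normal_subsemigroup.intros)
next
  case (mult a b)
  then obtain T U where "finite T" "T \<subseteq> S" "a \<in> normal_subsemigroup G T"
    "finite U" "U \<subseteq> S" "b \<in> normal_subsemigroup G U" by blast
  then show ?case
    using normal_subsemigroup_mono[of T "T \<union> U" G] normal_subsemigroup_mono[of U "T \<union> U" G]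
    by (intro exI[of _ "T \<union> U"]) (auto intro!: normal_subsemigroup.mult)
next
  case (conj a b)
  then show ?case by (meson normal_subsemigroup.conj)
qed

lemma normal_subsemigroup_subset_cone:
  assumes P: "order_cone G P" and "S \<subseteq> P"
  shows "normal_subsemigroup G S \<subseteq> P"
proof
  fix x assume "x \<in> normal_subsemigroup G S"
  then show "x \<in> P"
    using assms(2) by induction (auto intro: order_cone_mult[OF P] order_cone_conj[OF P])
qed

text \<open>Condition (3), with the signs chosen one after the other instead of all at once.\<close>

primrec refuted :: "('a, 'b) monoid_scheme \<Rightarrow> 'a set \<Rightarrow> 'a list \<Rightarrow> bool" where
  "refuted G T [] \<longleftrightarrow> \<one>\<^bsub>G\<^esub> \<in> normal_subsemigroup G T"
| "refuted G T (s # ss) \<longleftrightarrow> refuted G (insert s T) ss \<and> refuted G (insert (inv\<^bsub>G\<^esub> s) T) ss"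

lemma refuted_mono: "refuted G T ss \<Longrightarrow> T \<subseteq> U \<Longrightarrow> refuted G U ss"
proof (induction ss arbitrary: T U)
  case Nil
  then show ?case using normal_subsemigroup_mono[of T U G] by auto
next
  case (Cons s ss)
  then show ?case by simp (meson insert_mono)
qed

lemma refuted_append1: "refuted G T ss \<Longrightarrow> refuted G T (ss @ ss')"
proof (induction ss arbitrary: T)
  case Nil
  then show ?case
  proof (induction ss' arbitrary: T)
    case (Cons s ss')
    then show ?case
      using normal_subsemigroup_mono[of T "insert s T" G]
        normal_subsemigroup_mono[of T "insert (inv\<^bsub>G\<^esub> s) T" G] by auto
  qed simp
qed simp

text \<open>The elements of the prefix only enlarge the set that \<open>ss'\<close> refutes.
  Together with \<open>refuted_append1\<close> this lets two refutations merge into one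
  list.\<close>

lemma refuted_append2: "refuted G T ss' \<Longrightarrow> refuted G T (ss @ ss')"
proof (induction ss arbitrary: T)
  case (Cons s ss)
  then show ?case
    using refuted_mono[of G T ss' "insert s T"] refuted_mono[of G T ss' "insert (inv\<^bsub>G\<^esub> s) T"]
    by auto
qed simp

lemma refuted_finite_support:
  "refuted G T ss \<Longrightarrow> \<exists>U. finite U \<and> U \<subseteq> T \<and> refuted G U ss"
proof (induction ss arbitrary: T)
  case Nil
  then show ?case using normal_subsemigroup_finite_support[of "\<one>\<^bsub>G\<^esub>" G T] by auto
next
  case (Cons s ss)
  then obtain U V where U: "finite U" "U \<subseteq> insert s T" "refuted G U ss"
    and V: "finite V" "V \<subseteq> insert (inv\<^bsub>G\<^esub> s) T" "refuted G V ss"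
    by (metis refuted.simps(2))
  \<comment> \<open>Intersecting with \<open>T\<close> discards the tentative \<open>s\<close> and
    \<open>inv s\<close>, which the two branches put back.\<close>
  let ?W = "(U \<union> V) \<inter> T"
  have "refuted G (insert s ?W) ss" using U refuted_mono[of G U ss "insert s ?W"] by blast
  moreover have "refuted G (insert (inv\<^bsub>G\<^esub> s) ?W) ss"
    using V refuted_mono[of G V ss "insert (inv\<^bsub>G\<^esub> s) ?W"] by blast
  ultimately show ?case using U V by (intro exI[of _ ?W]) auto
qed

context group
begin

lemma refuted_iff_signs:
  assumes "set ss \<subseteq> carrier G"
  shows "refuted G T ss \<longleftrightarrow>
    (\<forall>\<delta> :: nat \<Rightarrow> int. (\<forall>i<length ss. \<delta> i \<in> {-1, 1}) \<longrightarrow>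
      \<one> \<in> normal_subsemigroup G (T \<union> {ss ! i [^] \<delta> i | i. i < length ss}))"
  using assms
proof (induction ss arbitrary: T)
  case Nil
  then show ?case by simp
next
  case (Cons s ss)
  have pow: "s [^] (1 :: int) = s" "s [^] (- 1 :: int) = inv s"
    using Cons.prems by (auto simp: int_pow_neg)
  \<comment> \<open>Index 0 carries the sign of \<open>s\<close>; the signs of \<open>ss\<close> are
    those of \<delta> shifted by one.\<close>
  have sets: "T \<union> {(s # ss) ! i [^] \<delta> i | i. i < length (s # ss)}
      = insert (s [^] \<delta> 0) T \<union> {ss ! i [^] \<delta> (Suc i) | i. i < length ss}" for \<delta> :: "nat \<Rightarrow> int"
    unfolding setcompr_eq_image lessThan_def[symmetric]
    by (simp add: lessThan_Suc_eq_insert_0 image_image)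
  show ?case (is "_ \<longleftrightarrow> ?R")
  proof
    assume ref: "refuted G T (s # ss)"
    show ?R
    proof (intro allI impI)
      fix \<delta> :: "nat \<Rightarrow> int" assume \<delta>: "\<forall>i<length (s # ss). \<delta> i \<in> {-1, 1}"
      then have "s [^] \<delta> 0 \<in> {s, inv s}" using pow by auto
      then have "refuted G (insert (s [^] \<delta> 0) T) ss" using ref by auto
      moreover have "\<forall>i<length ss. \<delta> (Suc i) \<in> {-1, 1}" using \<delta> by auto
      ultimately show "\<one> \<in> normal_subsemigroup G
          (T \<union> {(s # ss) ! i [^] \<delta> i | i. i < length (s # ss)})"
        unfolding sets using Cons by simp
    qed
  next
    assume R: ?R
    have "refuted G (insert (s [^] \<epsilon>) T) ss" if "\<epsilon> \<in> {-1, 1}" for \<epsilon> :: int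
    proof -
      have "\<one> \<in> normal_subsemigroup G
          (insert (s [^] \<epsilon>) T \<union> {ss ! i [^] \<delta> i | i. i < length ss})"
        if "\<forall>i<length ss. \<delta> i \<in> {-1, 1}" for \<delta> :: "nat \<Rightarrow> int"
      proof -
        \<comment> \<open>\<open>case_nat\<close> puts the sign \<epsilon> of \<open>s\<close> in
          front of the signs \<delta> of \<open>ss\<close>.\<close>
        have "\<forall>i<length (s # ss). case_nat \<epsilon> \<delta> i \<in> {-1, 1}"
          using that \<open>\<epsilon> \<in> {-1, 1}\<close> by (auto split: nat.split)
        with R have "\<one> \<in> normal_subsemigroup G
            (T \<union> {(s # ss) ! i [^] (case_nat \<epsilon> \<delta> i) | i. i < length (s # ss)})" by blast
        then show ?thesis unfolding sets by simp
      qed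
      then show ?thesis using Cons by simp
    qed
    from this[of 1] this[of "- 1"] show "refuted G T (s # ss)" using pow by simp
  qed
qed

section \<open>Refutations versus cones\<close>

lemma not_refuted_if_cone:
  assumes P: "order_cone G P"
  shows "T \<subseteq> P \<Longrightarrow> set ss \<subseteq> carrier G - {\<one>} \<Longrightarrow> \<not> refuted G T ss"
proof (induction ss arbitrary: T)
  case Nil
  then show ?case
    using normal_subsemigroup_subset_cone[OF P] order_cone_one[OF P] by auto
next
  case (Cons s ss)
  \<comment> \<open>Follow the sign that puts \<open>s\<close> or its inverse into \<open>P\<close>;
    the set on that branch stays inside \<open>P\<close>.\<close>
  then show ?case using order_cone_total[OF P, of s] by auto
qed

lemma normal_subsemigroup_closed:
  assumes "S \<subseteq> carrier G"
  shows "normal_subsemigroup G S \<subseteq> carrier G"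
proof
  fix x assume "x \<in> normal_subsemigroup G S"
  then show "x \<in> carrier G" using assms by induction auto
qed

lemma cone_if_not_refuted:
  assumes "S \<subseteq> carrier G"
    and "\<And>ss. set ss \<subseteq> carrier G - {\<one>} \<Longrightarrow> \<not> refuted G S ss"
  shows "\<exists>P. order_cone G P \<and> S \<subseteq> P"
proof -
  define A where "A = {T. S \<subseteq> T \<and> T \<subseteq> carrier G \<and>
    (\<forall>ss. set ss \<subseteq> carrier G - {\<one>} \<longrightarrow> \<not> refuted G T ss)}"
  have "\<exists>M\<in>A. \<forall>X\<in>A. M \<subseteq> X \<longrightarrow> X = M"
  proof (rule subset_Zorn_nonempty)
    show "A \<noteq> {}" using assms by (auto simp: A_def)
  next
    fix C assume C: "C \<noteq> {}" "subset.chain A C"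
    have "\<not> refuted G (\<Union>C) ss" if ss: "set ss \<subseteq> carrier G - {\<one>}" for ss
    proof
      assume "refuted G (\<Union>C) ss"
      then obtain U where U: "finite U" "U \<subseteq> \<Union>C" "refuted G U ss"
        using refuted_finite_support[of G "\<Union>C" ss] by auto
      then obtain T where "T \<in> C" "U \<subseteq> T"
        using finite_subset_Union_chain[OF U(1,2) C] by blast
      then show False
        using C(2) ss refuted_mono[OF U(3), of T] by (auto simp: A_def subset.chain_def)
    qed
    moreover have "S \<subseteq> \<Union>C" "\<Union>C \<subseteq> carrier G"
      using C by (fastforce simp: A_def subset.chain_def)+
    ultimately show "\<Union>C \<in> A" by (simp add: A_def)
  qed
  then obtain M where M: "M \<in> A" and max: "\<And>X. X \<in> A \<Longrightarrow> M \<subseteq> X \<Longrightarrow> X = M"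
    by blast
  have sub: "S \<subseteq> M" "M \<subseteq> carrier G"
    and nref: "\<And>ss. set ss \<subseteq> carrier G - {\<one>} \<Longrightarrow> \<not> refuted G M ss"
    using M by (auto simp: A_def)
  have dich: "a \<in> M \<or> inv a \<in> M" if a: "a \<in> carrier G" "a \<noteq> \<one>" for a
  proof (rule ccontr)
    assume "\<not> (a \<in> M \<or> inv a \<in> M)"
    then have "insert a M \<notin> A" "insert (inv a) M \<notin> A"
      using max[of "insert a M"] max[of "insert (inv a) M"] by auto
    then obtain ss ss' where
      ss: "set ss \<subseteq> carrier G - {\<one>}" "refuted G (insert a M) ss"
      and ss': "set ss' \<subseteq> carrier G - {\<one>}" "refuted G (insert (inv a) M) ss'"
      using sub a unfolding A_def by blast
    \<comment> \<open>After \<open>a\<close>, the list \<open>ss\<close> closes the branch of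
      \<open>a\<close> and \<open>ss'\<close> closes that of its inverse; the surplus elements do no
      harm.\<close>
    have "refuted G M (a # ss @ ss')"
      using refuted_append1[OF ss(2), of ss'] refuted_append2[OF ss'(2), of ss] by simp
    then show False using nref[of "a # ss @ ss'"] ss ss' a by auto
  qed
  have "order_cone G (normal_subsemigroup G M)"
  proof (rule order_coneI)
    \<comment> \<open>That the empty list does not refute \<open>M\<close> says exactly that
      \<open>M\<close> does not generate the identity.\<close>
    show "\<one> \<notin> normal_subsemigroup G M" using nref[of "[]"] by simp
  qed (use dich normal_subsemigroup_closed[OF sub(2)] in \<open>auto intro: normal_subsemigroup.intros\<close>)
  moreover have "S \<subseteq> normal_subsemigroup G M"
    using sub by (auto intro: normal_subsemigroup.intros)
  ultimately show ?thesis by blast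
qed

text \<open>Holds in any group; (2) and (3) are the instance for the free group and the images of
  the terms.\<close>

theorem not_extends_to_order_iff:
  assumes "S \<subseteq> carrier G"
  shows "\<not> extends_to_order G S \<longleftrightarrow>
    (\<exists>ss. set ss \<subseteq> carrier G - {\<one>} \<and>
      (\<forall>\<delta> :: nat \<Rightarrow> int. (\<forall>i<length ss. \<delta> i \<in> {-1, 1}) \<longrightarrow>
        \<one> \<in> normal_subsemigroup G (S \<union> {ss ! i [^] \<delta> i | i. i < length ss})))"
    (is "_ \<longleftrightarrow> ?R")
proof -
  have "\<not> extends_to_order G S \<longleftrightarrow> (\<exists>ss. set ss \<subseteq> carrier G - {\<one>} \<and> refuted G S ss)"
    unfolding extends_to_order_iff_cone[OF assms]
    using not_refuted_if_cone cone_if_not_refuted[OF assms] by meson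
  also have "\<dots> \<longleftrightarrow> ?R"
    by (intro ex_cong1 conj_cong refl refuted_iff_signs) auto
  finally show ?thesis .
qed

end


section \<open>The Magnus expansion and an order of the free group\<close>

text \<open>
  A formal power series in noncommuting variables is the function from monomials
  (words over the indices) to coefficients. The letter \<open>x\<^sub>i\<close> acts by left multiplication with
  \<open>1 + X\<^sub>i\<close> and its inverse by left multiplication with \<open>1 - X\<^sub>i + X\<^sub>i\<^sup>2 - \<dots>\<close>.
\<close>

fun letter_act :: "letter \<Rightarrow> (nat list \<Rightarrow> int) \<Rightarrow> nat list \<Rightarrow> int" where
  "letter_act a f [] = f []"
| "letter_act a f (j # v) =
    f (j # v) + (if fst a = j then if snd a then f v else - letter_act a f v else 0)"

definition magnus :: "letter list \<Rightarrow> nat list \<Rightarrow> int" where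
  "magnus w = foldr letter_act w (\<lambda>v. if v = [] then 1 else 0)"

text \<open>Multiplication of noncommutative power series.\<close>

definition conv :: "(nat list \<Rightarrow> int) \<Rightarrow> (nat list \<Rightarrow> int) \<Rightarrow> nat list \<Rightarrow> int" where
  "conv f g w = (\<Sum>n\<le>length w. f (take n w) * g (drop n w))"

section \<open>The Magnus expansion is multiplicative\<close>

lemma letter_act_cancel:
  assumes "cancels a b"
  shows "letter_act a (letter_act b f) = f"
proof
  fix v show "letter_act a (letter_act b f) v = f v"
    using assms by (induction v) (auto simp: cancels_def)
qed

text \<open>Free reduction cancels only mutually inverse operators, so the action of words factors
  through the free group.\<close>

lemma foldr_letter_act_push: "foldr letter_act (push a w) f = letter_act a (foldr letter_act w f)"
  by (cases w) (auto simp: letter_act_cancel)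

lemma foldr_letter_act_mult:
  "foldr letter_act (foldr push u w) f = foldr letter_act u (foldr letter_act w f)"
  by (induction u) (auto simp: foldr_letter_act_push)

lemma magnus_Nil_word: "magnus [] v = (if v = [] then 1 else 0)"
  by (simp add: magnus_def)

lemma magnus_Cons: "magnus (a # w) = letter_act a (magnus w)"
  by (simp add: magnus_def)

lemma magnus_at_Nil: "magnus w [] = 1"
  by (induction w) (auto simp: magnus_Cons magnus_Nil_word)

lemma conv_Nil: "conv f g [] = f [] * g []"
  by (simp add: conv_def)

text \<open>The summand with empty prefix is split off; every other prefix begins with
  \<open>j\<close>.\<close>

lemma conv_Cons: "conv f g (j # v) = f [] * g (j # v) + conv (\<lambda>u. f (j # u)) g v"
  unfolding conv_def by (simp only: list.size(4) add_Suc_right add_0_right sum.atMost_Suc_shift) simp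

lemma conv_add: "conv (\<lambda>u. f u + f' u) g v = conv f g v + conv f' g v"
  by (simp add: conv_def sum.distrib distrib_right)

lemma conv_one: "conv (\<lambda>v. if v = [] then 1 else 0) g = g"
proof
  fix v show "conv (\<lambda>v. if v = [] then 1 else 0) g v = g v"
    by (cases v) (auto simp: conv_Nil conv_Cons, simp add: conv_def)
qed

lemma letter_act_conv_pos: "letter_act (i, True) (conv f g) = conv (letter_act (i, True) f) g"
proof
  fix v show "letter_act (i, True) (conv f g) v = conv (letter_act (i, True) f) g v"
    by (cases v) (auto simp: conv_Nil conv_Cons conv_add, simp add: conv_def)
qed

text \<open>For an inverse letter, \<open>f\<close> is \<open>1 + X_i\<close> times
  \<open>letter_act a f\<close>; this factor is pulled out of the product and cancelled.\<close>

lemma letter_act_conv: "letter_act a (conv f g) = conv (letter_act a f) g"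
proof (cases "snd a")
  case True
  then show ?thesis using letter_act_conv_pos[of "fst a"] by (cases a) simp
next
  case False
  then obtain i where a: "a = (i, False)" by (cases a) auto
  have ca: "cancels (i, True) a" "cancels a (i, True)" by (simp_all add: a cancels_def)
  have "letter_act a (conv f g) = letter_act a (conv (letter_act (i, True) (letter_act a f)) g)"
    by (simp only: letter_act_cancel[OF ca(1)])
  also have "\<dots> = conv (letter_act a f) g"
    by (simp only: letter_act_conv_pos[symmetric] letter_act_cancel[OF ca(2)])
  finally show ?thesis .
qed

text \<open>By \<open>letter_act_conv\<close>, a word acts as multiplication by its own
  series.\<close>

lemma magnus_mult: "magnus (foldr push u w) = conv (magnus u) (magnus w)"
proof -
  have "foldr letter_act u g = conv (magnus u) g" for g
    by (induction u) (auto simp: magnus_def conv_one letter_act_conv)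
  moreover have "magnus (foldr push u w) = foldr letter_act u (magnus w)"
    by (simp add: magnus_def foldr_letter_act_mult)
  ultimately show ?thesis by simp
qed

text \<open>Powers \<open>X_i^n\<close> with \<open>n \<ge> 2\<close> contribute nothing at a
  monomial without equal neighbours, so an inverse letter acts there as
  \<open>1 - X_i\<close>.\<close>

lemma letter_act_distinct_adj:
  assumes "distinct_adj (j # v)"
  shows "letter_act a f (j # v) =
    f (j # v) + (if fst a = j then (if snd a then 1 else - 1) * f v else 0)"
  using assms by (cases v) auto

text \<open>
  For the reduced word \<open>x\<^bsub>i\<^sub>1\<^esub>\<^bsup>n\<^sub>1\<^esup> \<cdots> x\<^bsub>i\<^sub>r\<^esub>\<^bsup>n\<^sub>r\<^esup>\<close> the coefficient of
  \<open>m = X\<^bsub>i\<^sub>1\<^esub> \<cdots> X\<^bsub>i\<^sub>r\<^esub>\<close> is \<open>n\<^sub>1 \<cdots> n\<^sub>r\<close> and that of \<open>tl m\<close> is \<open>n\<^sub>2 \<cdots> n\<^sub>r\<close>. Instead of tracking the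
  exponents the induction tracks only that their quotient \<open>n\<^sub>1\<close> has the sign of the first letter.
\<close>

lemma magnus_syllables:
  assumes "reduced w"
  defines "m \<equiv> remdups_adj (map fst w)"
  shows "(\<forall>v. distinct_adj v \<longrightarrow> length m \<le> length v \<longrightarrow> v \<noteq> m \<longrightarrow> magnus w v = 0) \<and>
    magnus w m \<noteq> 0 \<and>
    (w \<noteq> [] \<longrightarrow> 0 < (if snd (hd w) then 1 else - 1) * magnus w m * magnus w (tl m) \<and>
      (\<forall>v. distinct_adj (hd m # v) \<longrightarrow> length m \<le> Suc (length v) \<longrightarrow> v \<noteq> tl m \<longrightarrow> magnus w v = 0))"
  using assms(1) unfolding m_def
proof (induction w)
  case Nil
  then show ?case by (auto simp: magnus_Nil_word)
next
  case (Cons a w)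
  obtain i b where a: "a = (i, b)" by (cases a)
  let ?m = "remdups_adj (map fst w)"
  let ?s = "if b then 1 else - 1 :: int"
  have red: "reduced w" and nc: "w = [] \<or> \<not> cancels a (hd w)"
    using Cons.prems by (auto simp: reduced_def successively_Cons)
  have zero: "magnus w v = 0" if "distinct_adj v" "length ?m \<le> length v" "v \<noteq> ?m" for v
    using Cons.IH[OF red] that by blast
  have nz: "magnus w ?m \<noteq> 0" using Cons.IH[OF red] by blast
  have adj: "distinct_adj ?m" by simp
  show ?case
  \<comment> \<open>Either the new letter lengthens the first syllable of \<open>w\<close> and the
    monomial stays the same, or it opens a new syllable and prepends \<open>i\<close>.\<close>
  proof (cases "w \<noteq> [] \<and> fst (hd w) = i")
    case True
    then have m: "remdups_adj (map fst (a # w)) = ?m"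
      using a by (cases w) (auto simp: remdups_adj_Cons')
    have b: "snd (hd w) = b" using True nc a by (auto simp: cancels_def)
    have "?m \<noteq> []" "hd ?m = i" using True by (auto simp: hd_map)
    then obtain m2 where m2: "?m = i # m2" by (cases ?m) auto
    have sg: "0 < ?s * magnus w ?m * magnus w m2"
      using Cons.IH[OF red] True b m2 by auto
    have zero2: "magnus w v = 0"
      if "distinct_adj (i # v)" "length m2 \<le> length v" "v \<noteq> m2" for v
      using Cons.IH[OF red] True m2 that by auto
    \<comment> \<open>\<open>distinct_adj (i # v)\<close> says in particular that \<open>v\<close>
      does not begin with \<open>i\<close>, so no multiple of \<open>X_i\<close>
      contributes.\<close>
    have act: "magnus (a # w) v = magnus w v" if "distinct_adj (i # v)" for v
      using that by (cases v) (auto simp: magnus_Cons a)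
    have m2': "magnus (a # w) m2 = magnus w m2"
      using adj unfolding m2 by (rule act)
    have m': "magnus (a # w) ?m = magnus w ?m + ?s * magnus w m2"
      using adj letter_act_distinct_adj[of i m2 a "magnus w"] unfolding m2 magnus_Cons by (simp add: a)
    \<comment> \<open>Since \<open>?s\<close> squares to 1, lengthening the syllable adds a square
      to the signed product, so the coefficient cannot cancel.\<close>
    have "?s * magnus (a # w) ?m * magnus (a # w) m2
        = ?s * magnus w ?m * magnus w m2 + magnus w m2 * magnus w m2"
      unfolding m' m2' by (cases b) (simp_all add: algebra_simps)
    then have sg': "0 < ?s * magnus (a # w) ?m * magnus (a # w) m2"
      using sg zero_le_square[of "magnus w m2"] by linarith
    have "magnus (a # w) v = 0"
      if v: "distinct_adj v" "length ?m \<le> length v" "v \<noteq> ?m" for v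
    proof -
      obtain j u where u: "v = j # u" using v m2 by (cases v) auto
      have "magnus w u = 0" if "i = j"
        using v u m2 that by (intro zero2) auto
      then show ?thesis
        using zero[OF v] v(1) letter_act_distinct_adj[of j u a "magnus w"]
        unfolding u magnus_Cons by (auto simp: a)
    qed
    moreover have "magnus (a # w) v = 0"
      if "distinct_adj (hd ?m # v)" "length ?m \<le> Suc (length v)" "v \<noteq> tl ?m" for v
      using act zero2 that m2 by simp
    moreover have "magnus (a # w) ?m \<noteq> 0" using sg' by auto
    moreover have "tl ?m = m2" "snd (hd (a # w)) = b" using m2 a by simp_all
    ultimately show ?thesis
      unfolding m using sg' by simp
  next
    case False
    then have m: "remdups_adj (map fst (a # w)) = i # ?m"
      using a by (cases w) (auto simp: remdups_adj_Cons')
    have adj': "distinct_adj (i # ?m)" using distinct_adj_remdups_adj[of "map fst (a # w)"] unfolding m .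
    have act: "magnus (a # w) v = magnus w v" if "distinct_adj (i # v)" for v
      using that by (cases v) (auto simp: magnus_Cons a)
    have m1: "magnus (a # w) ?m = magnus w ?m"
      using adj' by (rule act)
    \<comment> \<open>Only \<open>X_i\<close> times \<open>?m\<close> contributes: the coefficient
      of \<open>w\<close> at the longer monomial \<open>i # ?m\<close> is zero.\<close>
    have m2: "magnus (a # w) (i # ?m) = ?s * magnus w ?m"
      using adj' zero[of "i # ?m"] letter_act_distinct_adj[of i ?m a "magnus w"]
      unfolding magnus_Cons by (simp add: a)
    have "0 < magnus w ?m * magnus w ?m" using nz by (auto simp: zero_less_mult_iff)
    then have sg': "0 < ?s * magnus (a # w) (i # ?m) * magnus (a # w) ?m"
      unfolding m1 m2 by auto
    have "magnus (a # w) v = 0"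
      if v: "distinct_adj v" "length (i # ?m) \<le> length v" "v \<noteq> i # ?m" for v
    proof -
      obtain j u where u: "v = j # u" using v by (cases v) auto
      have "magnus w v = 0" using v by (intro zero) auto
      moreover have "magnus w u = 0" if "i = j"
        using v u that by (intro zero) (auto dest: distinct_adj_ConsD)
      ultimately show ?thesis
        using v(1) letter_act_distinct_adj[of j u a "magnus w"]
        unfolding u magnus_Cons by (auto simp: a)
    qed
    moreover have "magnus (a # w) v = 0"
      if "distinct_adj (i # v)" "length ?m \<le> length v" "v \<noteq> ?m" for v
      using act zero that by (auto dest: distinct_adj_ConsD)
    moreover have "magnus (a # w) (i # ?m) \<noteq> 0" using sg' by auto
    moreover have "snd (hd (a # w)) = b" using a by simp
    ultimately show ?thesis
      unfolding m using sg' by simp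
  qed
qed

text \<open>The least monomial of \<open>f - 1\<close>; the empty monomial is skipped since the
  series in question have constant term 1.\<close>

definition leading :: "(nat list \<Rightarrow> int) \<Rightarrow> nat list \<Rightarrow> bool" where
  "leading f w \<longleftrightarrow> w \<noteq> [] \<and> f w \<noteq> 0 \<and>
    (\<forall>v. v \<noteq> [] \<longrightarrow> (v, w) \<in> lenlex less_than \<longrightarrow> f v = 0)"

lemma leading_exists:
  assumes "w \<noteq> []" "f w \<noteq> 0"
  shows "\<exists>w. leading f w"
proof -
  have "wf (lenlex less_than)" by (intro wf_lenlex wf_less_than)
  moreover have "w \<in> {w. w \<noteq> [] \<and> f w \<noteq> 0}" using assms by simp
  ultimately obtain z where "z \<in> {w. w \<noteq> [] \<and> f w \<noteq> 0}"
    "\<And>y. (y, z) \<in> lenlex less_than \<Longrightarrow> y \<notin> {w. w \<noteq> [] \<and> f w \<noteq> 0}"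
    by (rule wfE_min) blast
  then show ?thesis unfolding leading_def by blast
qed

section \<open>Leading monomials of products, conjugates and inverses\<close>

lemma leading_shorter: "leading f w \<Longrightarrow> v \<noteq> [] \<Longrightarrow> length v < length w \<Longrightarrow> f v = 0"
  by (simp add: leading_def lenlex_conv)

lemma leading_cong:
  assumes "leading f w" "g w \<noteq> 0"
    and "\<And>v. v \<noteq> [] \<Longrightarrow> length v \<le> length w \<Longrightarrow> f v = 0 \<Longrightarrow> g v = 0"
  shows "leading g w"
  using assms lenlex_length[of _ w less_than] unfolding leading_def by blast

text \<open>With the factors written as \<open>1 + F\<close> and \<open>1 + G\<close>, the product
  is \<open>1 + F + G + F G\<close>, and the last hypothesis kills \<open>F G\<close> at
  \<open>w\<close>.\<close>

lemma conv_eq_add: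
  assumes "f [] = 1" "g [] = 1" "w \<noteq> []"
    and "\<And>n. 0 < n \<Longrightarrow> n < length w \<Longrightarrow> f (take n w) = 0 \<or> g (drop n w) = 0"
  shows "conv f g w = f w + g w"
proof -
  have "conv f g w = (\<Sum>n\<in>{0, length w}. f (take n w) * g (drop n w))"
    unfolding conv_def
  proof (rule sum.mono_neutral_right)
    show "\<forall>n\<in>{..length w} - {0, length w}. f (take n w) * g (drop n w) = 0"
    proof
      fix n assume "n \<in> {..length w} - {0, length w}"
      then have "0 < n" "n < length w" by auto
      then show "f (take n w) * g (drop n w) = 0" using assms(4)[of n] by auto
    qed
  qed auto
  then show ?thesis using assms by simp
qed

lemma conv_eq_add_short:
  assumes "f [] = 1" "g [] = 1" "w \<noteq> []"
    and "(\<forall>v. v \<noteq> [] \<longrightarrow> length v < length w \<longrightarrow> f v = 0) \<or>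
      (\<forall>v. v \<noteq> [] \<longrightarrow> length v < length w \<longrightarrow> g v = 0)"
  shows "conv f g w = f w + g w"
  using assms by (intro conv_eq_add) auto

text \<open>The smaller of \<open>u\<close> and \<open>v\<close> leads the product: up to its length
  the coefficients add, and if \<open>u = v\<close> two positive coefficients cannot cancel.\<close>

lemma leading_conv:
  assumes 1: "f [] = 1" "g [] = 1" and u: "leading f u" "0 < f u" and v: "leading g v" "0 < g v"
  shows "\<exists>w. leading (conv f g) w \<and> 0 < conv f g w"
proof -
  have add: "conv f g w = f w + g w"
    if "w \<noteq> []" "length w \<le> length u \<or> length w \<le> length v" for w
    using that 1 leading_shorter[OF u(1)] leading_shorter[OF v(1)]
    by (intro conv_eq_add_short) auto
  have ne: "u \<noteq> []" "v \<noteq> []" using u v by (auto simp: leading_def)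
  have fu: "f x = 0" if "x \<noteq> []" "(x, u) \<in> lenlex less_than" for x
    using u(1) that by (auto simp: leading_def)
  have gv: "g x = 0" if "x \<noteq> []" "(x, v) \<in> lenlex less_than" for x
    using v(1) that by (auto simp: leading_def)
  note tr = lenlex_trans[OF _ _ trans_less_than]
  consider "u = v" | "(u, v) \<in> lenlex less_than" | "(v, u) \<in> lenlex less_than"
    using total_lenlex[OF total_less_than] by (auto simp: total_on_def)
  then show ?thesis
  proof cases
    case 1
    then have "leading (conv f g) u"
      using add fu gv ne u v lenlex_length[of _ u less_than] by (auto simp: leading_def)
    then show ?thesis using 1 add ne u v by auto
  next
    case 2
    then have "leading (conv f g) u"
      using add fu gv ne u lenlex_length[of _ u less_than] tr[OF _ 2] by (auto simp: leading_def)
    then show ?thesis using gv[OF ne(1) 2] add ne u by auto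
  next
    case 3
    then have "leading (conv f g) v"
      using add fu gv ne v lenlex_length[of _ v less_than] tr[OF _ 3] by (auto simp: leading_def)
    then show ?thesis using fu[OF ne(2) 3] add ne v by auto
  qed
qed

text \<open>Conjugation preserves the lowest-degree part, because
  \<open>(f' - 1) h = h (f - 1)\<close> and \<open>h\<close> has constant term 1.\<close>

lemma leading_conj:
  assumes 1: "f [] = 1" "f' [] = 1" "h [] = 1" and eq: "conv f' h = conv h f"
    and w: "leading f w"
  shows "leading f' w" "f' w = f w"
proof -
  have agree: "f' v = f v" if "v \<noteq> []" "length v \<le> length w" for v
    using that
  proof (induction v rule: length_induct)
    case (1 v)
    \<comment> \<open>By induction \<open>f'\<close> agrees with \<open>f\<close> on shorter
      monomials, and \<open>f\<close> vanishes on nonempty monomials shorter than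
      \<open>w\<close>.\<close>
    have "f' x = 0" if "x \<noteq> []" "length x < length v" for x
      using 1 that leading_shorter[OF w, of x] by auto
    then have "conv f' h v = f' v + h v"
      using assms 1 by (intro conv_eq_add_short) auto
    moreover have "conv h f v = h v + f v"
      using assms 1 leading_shorter[OF w] by (intro conv_eq_add_short) auto
    ultimately show ?case using eq by simp
  qed
  then show "f' w = f w" using w by (auto simp: leading_def)
  then show "leading f' w" using agree w by (intro leading_cong[OF w]) (auto simp: leading_def)
qed

text \<open>Up to the length of \<open>w\<close> the product is
  \<open>1 + (f - 1) + (f' - 1)\<close>, so \<open>f'\<close> takes the opposite values at nonempty
  monomials.\<close>

lemma leading_inverse:
  assumes "f [] = 1" "f' [] = 1" and eq: "\<And>v. v \<noteq> [] \<Longrightarrow> conv f f' v = 0"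
    and w: "leading f w"
  shows "leading f' w" "f' w = - f w"
proof -
  have agree: "f' v = - f v" if "v \<noteq> []" "length v \<le> length w" for v
    using conv_eq_add_short[of f f' v, OF assms(1,2) that(1)] leading_shorter[OF w] that eq[OF that(1)] by auto
  then show "f' w = - f w" using w by (auto simp: leading_def)
  then show "leading f' w" using agree w by (intro leading_cong[OF w]) (auto simp: leading_def)
qed

section \<open>An order of the free group\<close>

lemma free_group_orderable: "\<exists>P. order_cone (free_group k) P"
proof -
  let ?F = "free_group k"
  interpret F: group ?F by (rule free_group_is_group)
  have one: "\<one>\<^bsub>?F\<^esub> = []" by (simp add: free_group_def)
  have mult: "magnus (x \<otimes>\<^bsub>?F\<^esub> y) = conv (magnus x) (magnus y)" for x y
    by (simp add: free_group_def magnus_mult)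
  note 1 = magnus_at_Nil
  let ?P = "{x \<in> carrier ?F. \<exists>w. leading (magnus x) w \<and> 0 < magnus x w}"
  have "order_cone ?F ?P"
  proof (rule order_coneI)
    show "\<one>\<^bsub>?F\<^esub> \<notin> ?P" by (auto simp: one leading_def magnus_Nil_word)
  next
    fix a b assume "a \<in> ?P" "b \<in> ?P"
    then show "a \<otimes>\<^bsub>?F\<^esub> b \<in> ?P" 
      using leading_conv[of "magnus a" "magnus b", OF 1 1] by (auto simp: mult)
  next
    fix a c assume a: "a \<in> ?P" and c: "c \<in> carrier ?F"
    let ?b = "c \<otimes>\<^bsub>?F\<^esub> a \<otimes>\<^bsub>?F\<^esub> inv\<^bsub>?F\<^esub> c"
    \<comment> \<open>In this form the conjugation involves no series for the inverse of
      \<open>c\<close>.\<close>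
    have "?b \<otimes>\<^bsub>?F\<^esub> c = c \<otimes>\<^bsub>?F\<^esub> a" using a c by (simp add: F.m_assoc)
    then have eq: "conv (magnus ?b) (magnus c) = conv (magnus c) (magnus a)"
      by (metis mult)
    obtain w where w: "leading (magnus a) w" "0 < magnus a w" using a by auto
    show "?b \<in> ?P" using leading_conj[of "magnus a" "magnus ?b" "magnus c", OF 1 1 1 eq w(1)] w(2) a c by auto
  next
    fix a assume a: "a \<in> carrier ?F" "a \<noteq> \<one>\<^bsub>?F\<^esub>"
    then have "reduced a" "a \<noteq> []" by (auto simp: free_group_def)
    \<comment> \<open>The syllable monomial shows that the series is not 1; it need not be the
      leading monomial.\<close>
    then have "magnus a (remdups_adj (map fst a)) \<noteq> 0" "remdups_adj (map fst a) \<noteq> []"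
      using magnus_syllables[of a] by auto
    then obtain w where w: "leading (magnus a) w" using leading_exists by blast
    have "conv (magnus a) (magnus (inv\<^bsub>?F\<^esub> a)) v = 0" if "v \<noteq> []" for v
      using a that by (simp add: mult[symmetric] one magnus_Nil_word)
    from leading_inverse[of "magnus a" "magnus (inv\<^bsub>?F\<^esub> a)", OF 1 1 this w] have "leading (magnus (inv\<^bsub>?F\<^esub> a)) w"
      "magnus (inv\<^bsub>?F\<^esub> a) w = - magnus a w" by auto
    moreover have "magnus a w \<noteq> 0" using w by (simp add: leading_def)
    ultimately show "a \<in> ?P \<or> inv\<^bsub>?F\<^esub> a \<in> ?P"
      using w a by (cases "0 < magnus a w") (auto intro!: exI[of _ w])
  qed auto
  then show ?thesis by blast
qed


section \<open>Evaluating group terms\<close>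

lemma (in group) geval_closed:
  "(\<And>i. i \<in> gvars t \<Longrightarrow> \<rho> i \<in> carrier G) \<Longrightarrow> geval G \<rho> t \<in> carrier G"
  by (induction t) auto

lemma (in group_hom) hom_geval:
  assumes "\<And>i. i \<in> gvars t \<Longrightarrow> \<sigma> i \<in> carrier G" "\<And>i. i \<in> gvars t \<Longrightarrow> h (\<sigma> i) = \<tau> i"
  shows "h (geval G \<sigma> t) = geval H \<tau> t"
  using assms by (induction t) (auto simp: G.geval_closed)

section \<open>Homomorphisms of the free group induced by assignments\<close>

context group
begin

text \<open>Defined on all words, reduced or not, and independently of the rank, so that one
  function serves every \<open>free_group k\<close>.\<close>

definition word_eval :: "(nat \<Rightarrow> 'a) \<Rightarrow> letter list \<Rightarrow> 'a" where
  "word_eval \<rho> w = foldr (\<lambda>a x. (if snd a then \<rho> (fst a) else inv (\<rho> (fst a))) \<otimes> x) w \<one>"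

context
  fixes \<rho> :: "nat \<Rightarrow> 'a"
  assumes closed: "\<And>i. \<rho> i \<in> carrier G"
begin

lemma word_eval_Cons:
  "word_eval \<rho> (a # w) = (if snd a then \<rho> (fst a) else inv (\<rho> (fst a))) \<otimes> word_eval \<rho> w"
  by (simp add: word_eval_def)

lemma word_eval_closed: "word_eval \<rho> w \<in> carrier G"
  by (induction w) (auto simp: word_eval_Cons closed, simp add: word_eval_def)

lemma word_eval_push:
  "word_eval \<rho> (push a w) = (if snd a then \<rho> (fst a) else inv (\<rho> (fst a))) \<otimes> word_eval \<rho> w"
proof (cases w)
  case (Cons b v)
  then show ?thesis
    using inv_mult_cancel[OF closed word_eval_closed]
    by (auto simp: word_eval_Cons cancels_def)
qed (simp add: word_eval_Cons)

lemma word_eval_hom: "word_eval \<rho> \<in> hom (free_group k) G"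
proof (rule homI)
  fix u v
  show "word_eval \<rho> (u \<otimes>\<^bsub>free_group k\<^esub> v) = word_eval \<rho> u \<otimes> word_eval \<rho> v"
  proof (induction u)
    case Nil
    then show ?case using word_eval_closed by (simp add: free_group_def, simp add: word_eval_def)
  next
    case (Cons a u)
    then show ?case
      using word_eval_closed closed
      by (simp add: free_group_def word_eval_push word_eval_Cons m_assoc)
  qed
qed (rule word_eval_closed)

lemma word_eval_free_gen: "word_eval \<rho> (free_gen i) = \<rho> i"
  using closed by (simp add: word_eval_def free_gen_def)

end

end

lemma free_gen_closed: "i < k \<Longrightarrow> free_gen i \<in> carrier (free_group k)"
  by (simp add: free_gen_def free_group_def reduced_def)

lemma free_image_closed:
  assumes "gvars t \<subseteq> {..<k}"
  shows "free_image k t \<in> carrier (free_group k)"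
  using assms group.geval_closed[OF free_group_is_group, of t free_gen k]
  by (auto simp: free_image_def intro: free_gen_closed)

lemma hom_free_image:
  assumes "group H" "h \<in> hom (free_group k) H" "gvars t \<subseteq> {..<k}"
    and "\<And>i. i < k \<Longrightarrow> h (free_gen i) = \<rho> i"
  shows "h (free_image k t) = geval H \<rho> t"
proof -
  interpret group_hom "free_group k" H h
    using assms free_group_is_group by (simp add: group_hom_def group_hom_axioms_def)
  show ?thesis
    unfolding free_image_def using assms by (intro hom_geval) (auto intro: free_gen_closed)
qed


section \<open>Totally ordered groups\<close>

context l_group
begin

lemma lle_refl: "a \<in> carrier L \<Longrightarrow> lle L a a"
  using meet_join_absorb[of a "lmeet L a a"] join_meet_absorb[of a a] meet_closed[of a a]
  by (simp add: lle_def)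

lemma lle_antisym: "\<lbrakk>a \<in> carrier L; b \<in> carrier L; lle L a b; lle L b a\<rbrakk> \<Longrightarrow> a = b"
  using meet_comm[of a b] by (simp add: lle_def)

lemma lle_trans:
  assumes "a \<in> carrier L" "b \<in> carrier L" "c \<in> carrier L" "lle L a b" "lle L b c"
  shows "lle L a c"
  using assms meet_assoc[of a b c] by (simp add: lle_def)

lemma ljoin_absorb2: "\<lbrakk>a \<in> carrier L; b \<in> carrier L; lle L a b\<rbrakk> \<Longrightarrow> ljoin L a b = b"
  using join_meet_absorb[of b a] meet_comm[of a b] join_comm[of a b] by (simp add: lle_def)

lemma ljoin_absorb1: "\<lbrakk>a \<in> carrier L; b \<in> carrier L; lle L b a\<rbrakk> \<Longrightarrow> ljoin L a b = a"
  using ljoin_absorb2[of b a] join_comm[of a b] by simp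

end

context o_group
begin

text \<open>By totality the join is the larger of the two elements; this turns the inequation into a
  disjunction over the terms.\<close>

lemma lle_ljoin_iff:
  assumes "a \<in> carrier L" "b \<in> carrier L" "c \<in> carrier L"
  shows "lle L c (ljoin L a b) \<longleftrightarrow> lle L c a \<or> lle L c b"
  using total[OF assms(1,2)]
proof
  assume "lle L a b"
  then show ?thesis using assms lle_trans[of c a b] ljoin_absorb2 by auto
next
  assume "lle L b a"
  then show ?thesis using assms lle_trans[of c b a] ljoin_absorb1 by auto
qed

lemma lle_foldl_ljoin_iff:
  assumes "c \<in> carrier L" "x \<in> carrier L" "set xs \<subseteq> carrier L"
  shows "lle L c (foldl (ljoin L) x xs) \<longleftrightarrow> (\<exists>y\<in>set (x # xs). lle L c y)"
  using assms by (induction xs arbitrary: x) (auto simp: lle_ljoin_iff join_closed)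

text \<open>The positive cone of the dual order: where the inequation fails all terms are negative,
  and this cone makes them positive.\<close>

lemma negative_cone: "order_cone L {a \<in> carrier L. lle L a \<one> \<and> a \<noteq> \<one>}" (is "order_cone L ?Q")
proof (rule order_coneI)
  fix a b assume ab: "a \<in> ?Q" "b \<in> ?Q"
  then have "lle L (a \<otimes> b) a" using mult_mono[of b \<one> a \<one>] by auto
  then show "a \<otimes> b \<in> ?Q"
    using ab lle_trans[of "a \<otimes> b" a \<one>] lle_antisym[of a \<one>] by auto
next
  fix a c assume a: "a \<in> ?Q" and c: "c \<in> carrier L"
  then have "lle L (c \<otimes> a \<otimes> inv c) \<one>" using mult_mono[of a \<one> c "inv c"] by auto
  moreover have "c \<otimes> a \<otimes> inv c \<noteq> \<one>" using a c conj_eq_one[of c a] by auto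
  ultimately show "c \<otimes> a \<otimes> inv c \<in> ?Q" using a c by auto
next
  fix a assume a: "a \<in> carrier L" "a \<noteq> \<one>"
  have "lle L (inv a) \<one>" if "lle L \<one> a"
    using mult_mono[of \<one> a "inv a" \<one>] that a by auto
  then show "a \<in> ?Q \<or> inv a \<in> ?Q"
    using a total[of a \<one>] inv_eq_1_iff[of a] by (auto simp del: inv_eq_1_iff)
qed auto

end

text \<open>The definition compares elements only with the identity; left translation by
  \<open>a\<close> turns the comparison for \<open>inv a \<otimes> b\<close> into one of
  \<open>a\<close> and \<open>b\<close>.\<close>

lemma (in group) group_order_total:
  assumes r: "group_order G r" and G: "a \<in> carrier G" "b \<in> carrier G"
  shows "(a, b) \<in> r \<or> (b, a) \<in> r"
proof -
  have l: "(c \<otimes> a, c \<otimes> b) \<in> r"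
    if "a \<in> carrier G" "b \<in> carrier G" "c \<in> carrier G" "(a, b) \<in> r" for a b c
    using r that unfolding group_order_def by blast
  have "(\<one>, inv a \<otimes> b) \<in> r \<or> (inv a \<otimes> b, \<one>) \<in> r \<or> inv a \<otimes> b = \<one>"
    using r G unfolding group_order_def by (meson DiffE inv_closed m_closed)
  then show ?thesis
  proof (elim disjE)
    assume "(\<one>, inv a \<otimes> b) \<in> r"
    then show ?thesis using l[of \<one> "inv a \<otimes> b" a] G by (simp add: inv_mult_cancel)
  next
    assume "(inv a \<otimes> b, \<one>) \<in> r"
    then show ?thesis using l[of "inv a \<otimes> b" \<one> a] G by (simp add: inv_mult_cancel)
  next
    assume "inv a \<otimes> b = \<one>"
    then have "a \<otimes> (inv a \<otimes> b) = a" using G by simp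
    then have "a = b" using G by (simp add: inv_mult_cancel)
    then show ?thesis
      using r G by (auto simp: group_order_def partial_order_on_def preorder_on_def refl_on_def)
  qed
qed

text \<open>Validity concerns structures with carriers in a fixed type, so the group is copied there
  along \<iota>. The order is reversed so that positive elements become negative and refute the
  inequation.\<close>

lemma (in group) ogroup_copy_dual:
  fixes \<iota> :: "'a \<Rightarrow> 'c"
  assumes r: "group_order G r" and inj: "inj_on \<iota> (carrier G)"
  obtains L :: "'c lgroup" where "o_group L" "\<iota> \<in> hom G L"
    "\<And>a b. \<lbrakk>a \<in> carrier G; b \<in> carrier G\<rbrakk> \<Longrightarrow> lle L (\<iota> a) (\<iota> b) \<longleftrightarrow> (b, a) \<in> r"
proof -
  define \<kappa> where "\<kappa> = inv_into (carrier G) \<iota>"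
  have \<kappa>: "\<kappa> (\<iota> a) = a" if "a \<in> carrier G" for a
    using inj that by (simp add: \<kappa>_def)
  have inj': "\<iota> a = \<iota> b \<longleftrightarrow> a = b" if "a \<in> carrier G" "b \<in> carrier G" for a b
    using inj that by (auto dest: inj_onD)
  define L :: "'c lgroup" where "L =
    \<lparr>carrier = \<iota> ` carrier G, mult = (\<lambda>x y. \<iota> (\<kappa> x \<otimes> \<kappa> y)), one = \<iota> \<one>,
     lmeet = (\<lambda>x y. if (\<kappa> y, \<kappa> x) \<in> r then x else y),
     ljoin = (\<lambda>x y. if (\<kappa> y, \<kappa> x) \<in> r then y else x)\<rparr>"
  have sel: "carrier L = \<iota> ` carrier G" "x \<otimes>\<^bsub>L\<^esub> y = \<iota> (\<kappa> x \<otimes> \<kappa> y)" "\<one>\<^bsub>L\<^esub> = \<iota> \<one>"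
    "lmeet L x y = (if (\<kappa> y, \<kappa> x) \<in> r then x else y)"
    "ljoin L x y = (if (\<kappa> y, \<kappa> x) \<in> r then y else x)" for x y
    by (simp_all add: L_def)
  have tr: "(a, c) \<in> r" if "(a, b) \<in> r" "(b, c) \<in> r" for a b c
    using r that unfolding group_order_def partial_order_on_def preorder_on_def
    by (meson transD)
  have as: "a = b" if "(a, b) \<in> r" "(b, a) \<in> r" for a b
    using r that unfolding group_order_def partial_order_on_def
    by (meson antisymD)
  have rf: "(a, a) \<in> r" if "a \<in> carrier G" for a
    using r that by (auto simp: group_order_def partial_order_on_def preorder_on_def refl_on_def)
  have mono: "(c \<otimes> a \<otimes> d, c \<otimes> b \<otimes> d) \<in> r"
    if "a \<in> carrier G" "b \<in> carrier G" "c \<in> carrier G" "d \<in> carrier G" "(a, b) \<in> r" for a b c d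
    using r that unfolding group_order_def by (meson m_closed)
  note tot = group_order_total[OF r]
  have lle: "lle L (\<iota> a) (\<iota> b) \<longleftrightarrow> (b, a) \<in> r" if "a \<in> carrier G" "b \<in> carrier G" for a b
    using that rf by (auto simp: lle_def sel \<kappa> inj')
  have "group L"
  proof (rule groupI)
    fix x assume "x \<in> carrier L"
    then obtain a where a: "a \<in> carrier G" "x = \<iota> a" by (auto simp: sel)
    then show "\<exists>y\<in>carrier L. y \<otimes>\<^bsub>L\<^esub> x = \<one>\<^bsub>L\<^esub>"
      by (intro bexI[of _ "\<iota> (inv a)"]) (auto simp: sel \<kappa>)
  qed (auto simp: sel \<kappa> m_assoc)
  then interpret L: group L .
  have "o_group L"
  proof unfold_locales
    fix x y assume "x \<in> carrier L" "y \<in> carrier L"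
    then obtain a b where ab: "a \<in> carrier G" "b \<in> carrier G" "x = \<iota> a" "y = \<iota> b"
      by (auto simp: sel)
    show "lmeet L x y \<in> carrier L" "ljoin L x y \<in> carrier L"
      using ab by (auto simp: sel)
    show "lmeet L x y = lmeet L y x" "ljoin L x y = ljoin L y x"
      using ab tot[of a b] as[of a b] by (auto simp: sel \<kappa> inj')
    show "lmeet L x (ljoin L x y) = x" "ljoin L x (lmeet L x y) = x"
      using ab rf by (auto simp: sel \<kappa>)
    show "lle L x y \<or> lle L y x" using ab tot[of a b] lle by auto
  next
    fix x y z assume "x \<in> carrier L" "y \<in> carrier L" "z \<in> carrier L"
    then obtain a b c where ab: "a \<in> carrier G" "b \<in> carrier G" "c \<in> carrier G"
      "x = \<iota> a" "y = \<iota> b" "z = \<iota> c"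
      by (auto simp: sel)
    show "lmeet L (lmeet L x y) z = lmeet L x (lmeet L y z)"
      "ljoin L (ljoin L x y) z = ljoin L x (ljoin L y z)"
      using ab tot[of a b] tot[of b c] tr[of a b c] tr[of c b a] by (auto simp: sel \<kappa> inj' dest: as)
  next
    fix x y z w assume "x \<in> carrier L" "y \<in> carrier L" "z \<in> carrier L" "w \<in> carrier L"
      and xy: "lle L x y"
    then obtain a b c d where ab: "a \<in> carrier G" "b \<in> carrier G" "c \<in> carrier G" "d \<in> carrier G"
      "x = \<iota> a" "y = \<iota> b" "z = \<iota> c" "w = \<iota> d"
      by (auto simp: sel)
    then have "(b, a) \<in> r" using xy lle by auto
    then show "lle L (z \<otimes>\<^bsub>L\<^esub> x \<otimes>\<^bsub>L\<^esub> w) (z \<otimes>\<^bsub>L\<^esub> y \<otimes>\<^bsub>L\<^esub> w)"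
      using ab lle mono by (simp add: sel(2) \<kappa>)
  qed
  moreover have "\<iota> \<in> hom G L" by (rule homI) (auto simp: sel \<kappa>)
  ultimately show thesis using lle by (rule that)
qed


section \<open>Validity in representable \<open>\<ell>\<close>-groups\<close>

text \<open>If \<epsilon> holds in the o-groups, the models of \<epsilon> among the l-groups form a
  variety containing them, hence containing \<open>RG\<close>.\<close>

lemma class_satisfies_RG_iff:
  "class_satisfies (RG :: 'a lgroup set) \<epsilon> \<longleftrightarrow> (\<forall>L :: 'a lgroup. o_group L \<longrightarrow> satisfies L \<epsilon>)"
proof
  assume "class_satisfies (RG :: 'a lgroup set) \<epsilon>"
  moreover have "L \<in> RG" if "o_group L" for L :: "'a lgroup"
    unfolding RG_def variety_generated_by_def using that by blast
  ultimately show "\<forall>L :: 'a lgroup. o_group L \<longrightarrow> satisfies L \<epsilon>"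
    unfolding class_satisfies_def by blast
next
  assume valid: "\<forall>L :: 'a lgroup. o_group L \<longrightarrow> satisfies L \<epsilon>"
  let ?V = "{L :: 'a lgroup. l_group L \<and> (\<forall>\<epsilon>'\<in>{\<epsilon>}. satisfies L \<epsilon>')}"
  have "lgroup_variety ?V" unfolding lgroup_variety_def by blast
  moreover have "{L. o_group L} \<subseteq> ?V" using valid by (auto simp: o_group_def)
  ultimately have "RG \<subseteq> ?V" unfolding RG_def variety_generated_by_def by blast
  then show "class_satisfies (RG :: 'a lgroup set) \<epsilon>" by (auto simp: class_satisfies_def)
qed

lemma leval_lterm_of: "leval L \<rho> (lterm_of t) = geval L \<rho> t"
  by (induction t) auto

lemma leval_foldl_LJoin:
  "leval L \<rho> (foldl LJoin s ss) = foldl (ljoin L) (leval L \<rho> s) (map (leval L \<rho>) ss)"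
  by (induction ss arbitrary: s) auto

lemma (in o_group) satisfies_one_le_joins_iff:
  assumes "ts \<noteq> []"
  shows "satisfies L (lineq LOne (ljoins (map lterm_of ts))) \<longleftrightarrow>
    (\<forall>\<rho>. range \<rho> \<subseteq> carrier L \<longrightarrow> (\<exists>t\<in>set ts. lle L \<one> (geval L \<rho> t)))"
proof -
  obtain t ts' where ts: "ts = t # ts'" using assms by (cases ts) auto
  have "lmeet L \<one> (leval L \<rho> (ljoins (map lterm_of ts))) = \<one> \<longleftrightarrow>
    (\<exists>t\<in>set ts. lle L \<one> (geval L \<rho> t))" if "range \<rho> \<subseteq> carrier L" for \<rho>
  proof -
    have cl: "geval L \<rho> t \<in> carrier L" for t using that by (intro geval_closed) auto
    have "leval L \<rho> (ljoins (map lterm_of ts)) = foldl (ljoin L) (geval L \<rho> t) (map (geval L \<rho>) ts')"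
      by (simp add: ts ljoins_def leval_foldl_LJoin leval_lterm_of comp_def)
    then show ?thesis
      using lle_foldl_ljoin_iff[of \<one> "geval L \<rho> t" "map (geval L \<rho>) ts'"] cl
      by (auto simp: lle_def ts)
  qed
  then show ?thesis by (simp add: satisfies_def lineq_def)
qed

section \<open>The two implications between (1) and (2)\<close>

lemma not_extends_if_valid:
  assumes inf: "infinite (UNIV :: 'a set)" and "ts \<noteq> []"
    and vars: "\<forall>t\<in>set ts. gvars t \<subseteq> {..<k}"
    and valid: "class_satisfies (RG :: 'a lgroup set) (lineq LOne (ljoins (map lterm_of ts)))"
  shows "\<not> extends_to_order (free_group k) (free_image k ` set ts)"
proof
  let ?F = "free_group k"
  interpret F: group ?F by (rule free_group_is_group)
  assume "extends_to_order ?F (free_image k ` set ts)"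
  then obtain r where r: "group_order ?F r" "\<And>t. t \<in> set ts \<Longrightarrow> (\<one>\<^bsub>?F\<^esub>, free_image k t) \<in> r - Id"
    by (auto simp: extends_to_order_def)
  \<comment> \<open>The free group is countable and so injects into the infinite type
    \<open>'a\<close>.\<close>
  obtain j :: "nat \<Rightarrow> 'a" where "inj j" using infinite_countable_subset[OF inf] by blast
  then have "inj (j \<circ> to_nat)" by (intro inj_compose inj_to_nat)
  then have inj: "inj_on (j \<circ> to_nat) (carrier ?F)" by (rule inj_on_subset) simp
  define \<iota> :: "letter list \<Rightarrow> 'a" where "\<iota> = j \<circ> to_nat"
  obtain L :: "'a lgroup" where L: "o_group L" and hom: "\<iota> \<in> hom ?F L"
    and lle: "\<And>a b. \<lbrakk>a \<in> carrier ?F; b \<in> carrier ?F\<rbrakk> \<Longrightarrow> lle L (\<iota> a) (\<iota> b) \<longleftrightarrow> (b, a) \<in> r"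
    unfolding \<iota>_def using F.ogroup_copy_dual[OF r(1) inj] by blast
  interpret L: o_group L by (rule L)
  \<comment> \<open>Assignments cover all indices; from \<open>k\<close> on no term reads them, and
    the identity is the default.\<close>
  define \<rho> where "\<rho> i = (if i < k then \<iota> (free_gen i) else \<one>\<^bsub>L\<^esub>)" for i
  have "range \<rho> \<subseteq> carrier L"
    using hom by (auto simp: \<rho>_def hom_def intro: free_gen_closed)
  then obtain t where t: "t \<in> set ts" "lle L \<one>\<^bsub>L\<^esub> (geval L \<rho> t)"
    using valid L L.satisfies_one_le_joins_iff[OF \<open>ts \<noteq> []\<close>] unfolding class_satisfies_RG_iff by blast
  have "\<iota> (free_image k t) = geval L \<rho> t"
    using hom vars t(1) by (intro hom_free_image) (auto simp: \<rho>_def L.is_group)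
  moreover have "\<iota> \<one>\<^bsub>?F\<^esub> = \<one>\<^bsub>L\<^esub>" using hom_one[OF hom F.is_group L.is_group] .
  moreover have "free_image k t \<in> carrier ?F" using vars t(1) by (intro free_image_closed) auto
  \<comment> \<open>The order of \<open>L\<close> is reversed: a value above the identity comes from
    an element below the identity in \<open>r\<close>.\<close>
  ultimately have "(free_image k t, \<one>\<^bsub>?F\<^esub>) \<in> r"
    using t(2) lle[of "\<one>\<^bsub>?F\<^esub>" "free_image k t"] by auto
  moreover have "antisym r" using r(1) by (simp add: group_order_def partial_order_on_def)
  ultimately show False using r(2)[OF t(1)] by (auto dest: antisymD)
qed

lemma valid_if_not_extends:
  assumes "ts \<noteq> []" and vars: "\<forall>t\<in>set ts. gvars t \<subseteq> {..<k}"
    and nex: "\<not> extends_to_order (free_group k) (free_image k ` set ts)"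
  shows "class_satisfies (RG :: 'a lgroup set) (lineq LOne (ljoins (map lterm_of ts)))"
  unfolding class_satisfies_RG_iff
proof (intro allI impI)
  let ?F = "free_group k"
  interpret F: group ?F by (rule free_group_is_group)
  fix L :: "'a lgroup" assume "o_group L"
  then interpret L: o_group L .
  show "satisfies L (lineq LOne (ljoins (map lterm_of ts)))"
    unfolding L.satisfies_one_le_joins_iff[OF \<open>ts \<noteq> []\<close>]
  proof (intro allI impI, rule ccontr)
    fix \<rho> assume \<rho>: "range \<rho> \<subseteq> carrier L" and neg: "\<not> (\<exists>t\<in>set ts. lle L \<one>\<^bsub>L\<^esub> (geval L \<rho> t))"
    let ?h = "L.word_eval \<rho>"
    have cl: "\<rho> i \<in> carrier L" for i using \<rho> by auto
    have hom: "?h \<in> hom ?F L" by (rule L.word_eval_hom) (rule cl)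
    let ?Q = "{a \<in> carrier L. lle L a \<one>\<^bsub>L\<^esub> \<and> a \<noteq> \<one>\<^bsub>L\<^esub>}"
    obtain P where "order_cone ?F P" using free_group_orderable by blast
    \<comment> \<open>\<open>?h\<close> need not be injective, so \<open>P\<close> has to order its
      kernel.\<close>
    then have "order_cone ?F {a \<in> carrier ?F. ?h a \<in> ?Q \<or> ?h a = \<one>\<^bsub>L\<^esub> \<and> a \<in> P}"
      by (rule F.order_cone_lex[OF L.is_group hom L.negative_cone])
    moreover have "free_image k t \<in> carrier ?F \<and> ?h (free_image k t) \<in> ?Q" if "t \<in> set ts" for t
    proof -
      have "?h (free_image k t) = geval L \<rho> t"
        using vars that L.word_eval_free_gen[OF cl]
        by (intro hom_free_image hom) (auto simp: L.is_group)
      moreover have "geval L \<rho> t \<in> carrier L" using cl by (rule L.geval_closed)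
      moreover have "\<not> lle L \<one>\<^bsub>L\<^esub> (geval L \<rho> t)" using neg that by blast
      ultimately show ?thesis
        using L.total[of "geval L \<rho> t" "\<one>\<^bsub>L\<^esub>"] L.lle_refl[of "\<one>\<^bsub>L\<^esub>"] vars that
        by (auto intro!: free_image_closed)
    qed
    ultimately have "extends_to_order ?F (free_image k ` set ts)"
      by (subst F.extends_to_order_iff_cone) blast+
    with nex show False ..
  qed
qed

theorem theorem8:
  fixes k :: nat and ts :: "gterm list"
  assumes "infinite (UNIV :: 'a set)"
    and "ts \<noteq> []"
    and "\<forall>t\<in>set ts. gvars t \<subseteq> {..<k}"
  shows
    "(class_satisfies (RG :: 'a lgroup set) (lineq LOne (ljoins (map lterm_of ts)))
      \<longleftrightarrow> \<not> extends_to_order (free_group k) (free_image k ` set ts))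
    \<and>
    (\<not> extends_to_order (free_group k) (free_image k ` set ts)
      \<longleftrightarrow> (\<exists>ss. set ss \<subseteq> carrier (free_group k) - {\<one>\<^bsub>free_group k\<^esub>} \<and>
            (\<forall>\<delta> :: nat \<Rightarrow> int. (\<forall>i<length ss. \<delta> i \<in> {-1, 1}) \<longrightarrow>
              \<one>\<^bsub>free_group k\<^esub> \<in> normal_subsemigroup (free_group k)
                (free_image k ` set ts \<union>
                  {ss ! i [^]\<^bsub>free_group k\<^esub> \<delta> i | i. i < length ss}))))"
proof (rule conjI)
  show "class_satisfies (RG :: 'a lgroup set) (lineq LOne (ljoins (map lterm_of ts)))
      \<longleftrightarrow> \<not> extends_to_order (free_group k) (free_image k ` set ts)"
    using not_extends_if_valid[OF assms] valid_if_not_extends[OF assms(2,3)] by blast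
  have "free_image k ` set ts \<subseteq> carrier (free_group k)"
    using assms(3) by (auto intro: free_image_closed)
  then show "\<not> extends_to_order (free_group k) (free_image k ` set ts)
      \<longleftrightarrow> (\<exists>ss. set ss \<subseteq> carrier (free_group k) - {\<one>\<^bsub>free_group k\<^esub>} \<and>
            (\<forall>\<delta> :: nat \<Rightarrow> int. (\<forall>i<length ss. \<delta> i \<in> {-1, 1}) \<longrightarrow>
              \<one>\<^bsub>free_group k\<^esub> \<in> normal_subsemigroup (free_group k)
                (free_image k ` set ts \<union>
                  {ss ! i [^]\<^bsub>free_group k\<^esub> \<delta> i | i. i < length ss})))"
    by (rule group.not_extends_to_order_iff[OF free_group_is_group])
qed

end
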